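(* Let $n\ge1$ be odd. For every integer $k$ with $(n+1)/2\le k\le n$, $$\sum_{\nu=0}^{k}\binom{2k-n}{k-\nu}\,\mathfrak{B}_{n,\nu}=0.$$
   Context: $\mathbf{B}_n$ denotes the $n$-th Bernoulli number, defined by $\frac{t}{e^t-1}=\sum_{n\ge0}\mathbf{B}_n\frac{t^n}{n!}$ (so $\mathbf{B}_1=-\frac12$). The numbers $\mathfrak{B}_{n,k}$ are $$\mathfrak{B}_{n,k}=\sum_{\nu=k}^{n}\binom{n}{\nu}\binom{\nu}{k}\mathbf{B}_\nu\qquad(0\le k\le n).$$ *)

theory Defs
  imports "HOL-Computational_Algebra.Computational_Algebra"
begin

(* The library's division of formal power series over a field shifts out the common
   power of fps_X, so fps_X / (fps_exp 1 - 1) is the genuine series t / (e^t - 1);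
   in particular bernoulli_number 1 = -1/2. *)
definition bernoulli_number :: "nat \<Rightarrow> rat" where
  "bernoulli_number n = fact n * fps_nth (fps_X / (fps_exp 1 - 1)) n"

definition bernoulli_triangle :: "nat \<Rightarrow> nat \<Rightarrow> rat" where
  "bernoulli_triangle n k =
     (\<Sum>\<nu>=k..n. of_nat (n choose \<nu>) * of_nat (\<nu> choose k) * bernoulli_number \<nu>)"

end

theory Submission imports Defs begin

text \<open>
  Let \<open>L\<close> be the umbral functional on polynomials sending \<open>x^\<nu>\<close> to the Bernoulli number of
  index \<open>\<nu>\<close>. The functional equation \<open>G(-t) = e^t G(t)\<close> of \<open>G(t) = t / (e^t - 1)\<close> says
  \<open>L(p(x + 1)) = L(p(-x))\<close>, so \<open>L\<close> is invariant under the reflection \<open>x \<mapsto> -1 - x\<close>. The entry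
  of the triangle at \<open>(n, k)\<close> is \<open>n choose k\<close> times \<open>L(x^k (1 + x)^(n-k))\<close>, whence row \<open>n\<close> is
  antisymmetric for odd \<open>n\<close>. The sum pairs this row with the symmetric row \<open>2k - n\<close> of Pascal's
  triangle, so it equals its own negative.
\<close>

text \<open>Substituting \<open>-t\<close> into \<open>G(t) (e^t - 1) = t\<close> and multiplying by
  \<open>e^t\<close> turns the factor \<open>e^(-t) - 1\<close> into \<open>-(e^t - 1)\<close>,
  which is nonzero and can be cancelled.\<close>

lemma bernoulli_fps_reflect:
  fixes G :: "rat fps"
  assumes G: "G = fps_X / (fps_exp 1 - 1)"
  shows "fps_compose G (- fps_X) = G * fps_exp 1"
proof -
  let ?E = "fps_exp (1::rat)" and ?F = "fps_exp (-1::rat)"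
  have nz: "?E - 1 \<noteq> 0"
  proof
    assume "?E - 1 = 0"
    then have "fps_nth (?E - 1) 1 = 0" by simp
    then show False by simp
  qed
  \<comment> \<open>The linear coefficient of \<open>e^t - 1\<close> is 1, so this series divides
    \<open>fps_X\<close> and the quotient defining \<open>G\<close> is exact.\<close>
  have "subdegree (?E - 1) \<le> 1"
    by (rule subdegree_leI) simp
  then have "?E - 1 dvd fps_X"
    using nz by (subst fps_dvd_iff) auto
  then have GE: "G * (?E - 1) = fps_X"
    unfolding G by simp
  have EF: "?F * ?E = 1"
    by (simp add: fps_exp_add_mult [symmetric])
  have F: "fps_compose ?E (- fps_X) = ?F"
    by (rule fps_ext) (simp add: fps_compose_uminus')
  have "fps_compose (G * (?E - 1)) (- fps_X) = - fps_X"
    by (simp add: GE)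
  then have "fps_compose G (- fps_X) * (?F - 1) = - fps_X"
    by (simp add: fps_compose_mult_distrib fps_compose_sub_distrib F)
  then have "fps_compose G (- fps_X) * (?F - 1) * ?E = - fps_X * ?E"
    by simp
  also have "fps_compose G (- fps_X) * (?F - 1) * ?E = - (fps_compose G (- fps_X) * (?E - 1))"
    using EF by (simp add: algebra_simps)
  finally have "fps_compose G (- fps_X) * (?E - 1) = (G * ?E) * (?E - 1)"
    using GE by (simp add: algebra_simps)
  then show ?thesis
    using nz by simp
qed

text \<open>Compare the coefficients of \<open>t^n\<close> in \<open>G(-t) = e^t G(t)\<close>. This
  is the reflection property of the umbral functional on the monomial \<open>x^n\<close>.\<close>

lemma sum_binomial_bernoulli_number:
  "(\<Sum>j\<le>n. of_nat (n choose j) * bernoulli_number j) = (-1) ^ n * bernoulli_number n"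
proof -
  let ?G = "fps_X / (fps_exp 1 - 1) :: rat fps"
  have "(-1) ^ n * bernoulli_number n = fact n * fps_nth (fps_compose ?G (- fps_X)) n"
    by (simp add: bernoulli_number_def fps_compose_uminus')
  also have "\<dots> = fact n * (\<Sum>j\<le>n. fps_nth ?G j * (1 / fact (n - j)))"
    by (simp add: bernoulli_fps_reflect [OF refl] fps_mult_nth atLeast0AtMost)
  also have "\<dots> = (\<Sum>j\<le>n. of_nat (n choose j) * bernoulli_number j)"
    unfolding sum_distrib_left
    by (rule sum.cong) (auto simp: bernoulli_number_def binomial_fact)
  finally show ?thesis by simp
qed

definition bernoulli_umbral :: "rat poly \<Rightarrow> rat" where
  "bernoulli_umbral p = (\<Sum>i\<le>degree p. coeff p i * bernoulli_number i)"

text \<open>Coefficients beyond the degree vanish. A common bound \<open>N\<close> lets polynomials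
  of different degrees be compared termwise, which gives linearity.\<close>

lemma bernoulli_umbral_altdef:
  assumes "degree p \<le> N"
  shows "bernoulli_umbral p = (\<Sum>i\<le>N. coeff p i * bernoulli_number i)"
  unfolding bernoulli_umbral_def
  by (rule sum.mono_neutral_left) (use assms in \<open>auto simp: coeff_eq_0\<close>)

lemma bernoulli_umbral_add:
  "bernoulli_umbral (p + q) = bernoulli_umbral p + bernoulli_umbral q"
proof -
  define N where "N = max (degree p) (degree q)"
  have "degree p \<le> N" "degree q \<le> N" "degree (p + q) \<le> N"
    unfolding N_def by (auto simp: degree_add_le_max)
  then show ?thesis
    by (simp add: bernoulli_umbral_altdef [of _ N] algebra_simps sum.distrib)
qed

lemma bernoulli_umbral_smult: "bernoulli_umbral (smult c p) = c * bernoulli_umbral p"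
proof -
  have "degree (smult c p) \<le> degree p" by (rule degree_smult_le)
  then show ?thesis
    by (simp add: bernoulli_umbral_altdef [of _ "degree p"] sum_distrib_left mult.assoc)
qed

lemma bernoulli_umbral_sum: "bernoulli_umbral (sum f A) = (\<Sum>x\<in>A. bernoulli_umbral (f x))"
  by (induction A rule: infinite_finite_induct)
     (auto simp: bernoulli_umbral_add, auto simp: bernoulli_umbral_def)

lemma bernoulli_umbral_monom: "bernoulli_umbral (monom c n) = c * bernoulli_number n"
proof -
  have "degree (monom c n) \<le> n" by (rule degree_monom_le)
  then show ?thesis
    by (simp add: bernoulli_umbral_altdef [of _ n] if_distrib [of "\<lambda>x. x * _"] cong: if_cong)
qed

lemma linear_power_eq_sum_monom:
  "[:1, 1:] ^ m = (\<Sum>j\<le>m. monom (of_nat (m choose j)) j :: rat poly)"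
  by (rule poly_eqI) (auto simp: coeff_linear_poly_power coeff_sum degree_linear_power coeff_eq_0)

lemma pcompose_power: "pcompose (p ^ i) q = pcompose p q ^ i"
  by (induction i) (simp_all add: pcompose_1 pcompose_mult)

text \<open>Both sides are linear in \<open>p\<close>, so it suffices to treat powers of
  \<open>x\<close>, where \<open>(x + 1)^i\<close> and \<open>(-x)^i\<close> have equal images by
  \<open>sum_binomial_bernoulli_number\<close>.\<close>

lemma bernoulli_umbral_shift:
  "bernoulli_umbral (pcompose p [:1, 1:]) = bernoulli_umbral (pcompose p [:0, -1:])"
proof -
  have mon: "bernoulli_umbral ([:1, 1:] ^ i) = bernoulli_umbral ([:0, -1:] ^ i)" for i
  proof -
    have "[:0, -1:] = monom (-1 :: rat) 1" by (simp add: monom_altdef)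
    then have "[:0, -1:] ^ i = monom ((-1 :: rat) ^ i) i"
      by (simp add: monom_power)
    then show ?thesis
      by (simp add: linear_power_eq_sum_monom bernoulli_umbral_sum bernoulli_umbral_monom
          sum_binomial_bernoulli_number)
  qed
  have "bernoulli_umbral (pcompose p q) = (\<Sum>i\<le>degree p. coeff p i * bernoulli_umbral (q ^ i))" for q
  proof -
    have "pcompose p q = pcompose (\<Sum>i\<le>degree p. monom (coeff p i) i) q"
      by (simp add: poly_as_sum_of_monoms)
    also have "\<dots> = (\<Sum>i\<le>degree p. smult (coeff p i) (q ^ i))"
      by (simp add: pcompose_sum monom_altdef pcompose_smult pcompose_power pcompose_pCons)
    finally show ?thesis
      by (simp add: bernoulli_umbral_sum bernoulli_umbral_smult)
  qed
  then show ?thesis by (simp add: mon)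
qed

lemma bernoulli_umbral_reflect:
  "bernoulli_umbral (pcompose p [:-1, -1:]) = bernoulli_umbral p"
proof -
  \<comment> \<open>For \<open>p(x - 1)\<close>, the shift \<open>x + 1\<close> gives back
    \<open>p(x)\<close>, while \<open>-x\<close> gives \<open>p(-1 - x)\<close>.\<close>
  have "bernoulli_umbral (pcompose (pcompose p [:-1, 1:]) [:1, 1:]) =
        bernoulli_umbral (pcompose (pcompose p [:-1, 1:]) [:0, -1:])"
    by (rule bernoulli_umbral_shift)
  then show ?thesis
    by (simp add: pcompose_assoc [symmetric] pcompose_pCons pcompose_idR)
qed

text \<open>Put \<open>\<nu> = k + j\<close>, pull out \<open>n choose k\<close> by trinomial
  revision (\<open>choose_mult\<close>), and recognise the binomial expansion of
  \<open>x^k (1 + x)^(n-k)\<close>.\<close>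

lemma bernoulli_triangle_eq_umbral:
  assumes "k \<le> n"
  shows "bernoulli_triangle n k =
           of_nat (n choose k) * bernoulli_umbral ([:0, 1:] ^ k * [:1, 1:] ^ (n - k))"
proof -
  have "bernoulli_triangle n k =
          (\<Sum>j\<le>n - k. of_nat (n choose (k + j)) * of_nat ((k + j) choose k) * bernoulli_number (k + j))"
    unfolding bernoulli_triangle_def
    by (rule sum.reindex_bij_witness [of _ "\<lambda>j. k + j" "\<lambda>i. i - k"]) (use assms in auto)
  also have "\<dots> = (\<Sum>j\<le>n - k. of_nat (n choose k) * (of_nat ((n - k) choose j) * bernoulli_number (k + j)))"
  proof (rule sum.cong)
    fix j assume "j \<in> {..n - k}"
    then have "(n choose (k + j)) * ((k + j) choose k) = (n choose k) * ((n - k) choose j)"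
      using choose_mult [of k "k + j" n] assms by simp
    then have "(of_nat (n choose (k + j)) * of_nat ((k + j) choose k) :: rat)
                 = of_nat (n choose k) * of_nat ((n - k) choose j)"
      by (metis of_nat_mult)
    then show "of_nat (n choose (k + j)) * of_nat ((k + j) choose k) * bernoulli_number (k + j)
                 = of_nat (n choose k) * (of_nat ((n - k) choose j) * bernoulli_number (k + j))"
      by simp
  qed simp
  also have "\<dots> = of_nat (n choose k) * bernoulli_umbral (monom 1 k * [:1, 1:] ^ (n - k))"
    by (simp add: linear_power_eq_sum_monom sum_distrib_left mult_monom
        bernoulli_umbral_sum bernoulli_umbral_monom)
  finally show ?thesis by (simp add: monom_altdef)
qed

text \<open>The reflection \<open>x \<mapsto> -1 - x\<close> exchanges \<open>x\<close> and
  \<open>1 + x\<close> up to a sign in each of the \<open>k + (n - k) = n\<close> factors.\<close>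

lemma bernoulli_triangle_symmetric:
  assumes "k \<le> n"
  shows "bernoulli_triangle n (n - k) = (-1) ^ n * bernoulli_triangle n k"
proof -
  let ?p = "[:0, 1:] ^ k * [:1, 1:] ^ (n - k) :: rat poly"
  have "pcompose ?p [:-1, -1:] = [:-1, -1:] ^ k * [:0, -1:] ^ (n - k)"
    by (simp add: pcompose_mult pcompose_power pcompose_pCons)
  also have "\<dots> = smult (-1) [:1, 1:] ^ k * smult (-1) [:0, 1:] ^ (n - k)"
    by simp
  also have "\<dots> = smult ((-1) ^ n) ([:0, 1:] ^ (n - k) * [:1, 1:] ^ k)"
    using assms by (simp only: smult_power mult_smult_left mult_smult_right smult_smult
        power_add [symmetric] le_add_diff_inverse le_add_diff_inverse2 mult.commute)
  finally have "bernoulli_umbral ?p =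
      (-1) ^ n * bernoulli_umbral ([:0, 1:] ^ (n - k) * [:1, 1:] ^ k)"
    by (metis bernoulli_umbral_reflect bernoulli_umbral_smult)
  then show ?thesis
    using assms by (simp add: bernoulli_triangle_eq_umbral binomial_symmetric [symmetric])
qed

theorem corollary5p10:
  fixes n k :: nat
  assumes "n \<ge> 1" and "odd n"
    and "(n + 1) div 2 \<le> k" and "k \<le> n"
  shows "(\<Sum>\<nu>=0..k. of_nat ((2 * k - n) choose (k - \<nu>)) * bernoulli_triangle n \<nu>) = 0"
proof -
  let ?f = "\<lambda>\<nu>. of_nat ((2 * k - n) choose (k - \<nu>)) * bernoulli_triangle n \<nu>"
  have n2k: "n \<le> 2 * k" using assms by linarith
  \<comment> \<open>If \<open>\<nu> < n - k\<close>, then \<open>k - \<nu> > 2 * k - n\<close> and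
    the binomial coefficient is zero. The remaining range is stable under
    \<open>\<nu> \<mapsto> n - \<nu>\<close>.\<close>
  have "sum ?f {0..k} = sum ?f {n - k..k}"
    by (rule sum.mono_neutral_right) (use assms n2k in \<open>auto intro!: binomial_eq_0\<close>)
  also have "sum ?f {n - k..k} = (\<Sum>\<nu>=n - k..k. - ?f \<nu>)"
  proof (rule sum.reindex_bij_witness [of _ "\<lambda>\<nu>. n - \<nu>" "\<lambda>\<nu>. n - \<nu>"])
    fix \<nu> assume \<nu>: "\<nu> \<in> {n - k..k}"
    \<comment> \<open>The lower indices \<open>k - (n - \<nu>)\<close> and \<open>k - \<nu>\<close>
      add up to \<open>2 * k - n\<close>; on this range no natural subtraction is truncated.\<close>
    have "(2 * k - n) choose (k - (n - \<nu>)) = (2 * k - n) choose (k - \<nu>)"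
      using \<nu> n2k assms by (subst binomial_symmetric) (auto intro!: arg_cong2 [of _ _ _ _ binomial])
    then show "- ?f (n - \<nu>) = ?f \<nu>"
      using \<nu> assms by (simp add: bernoulli_triangle_symmetric)
  qed (use assms n2k in auto)
  finally have "sum ?f {0..k} = - sum ?f {n - k..k}" by (simp add: sum_negf)
  with \<open>sum ?f {0..k} = sum ?f {n - k..k}\<close> show ?thesis by simp
qed

end
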